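(* Assume that $\nabla f:X\to X$ is $\alpha$-strongly monotone for some $\alpha>0$, i.e. $\langle\nabla f(x)-\nabla f(y),x-y\rangle_X\ge\alpha\|x-y\|_X^2$ for all $x,y\in X$, and that the set $S\times M$ of saddle points of $L$ is non-empty. Let $(x,\lambda):[0,+\infty)\to X\times Y$ be a solution of the Arrow--Hurwicz differential system (AH) with initial data $(x_0,\lambda_0)\in X\times Y$, and let $(\bar x,\bar\lambda)\in S\times M$ be such that $(x(t),\lambda(t))\rightharpoonup(\bar x,\bar\lambda)$ weakly in $X\times Y$ as $t\to+\infty$. Then $$(\bar x,\bar\lambda)=\operatorname{proj}_{S\times M}(x_0,\lambda_0).$$
   Context: $X$ and $Y$ are real Hilbert spaces with inner products $\langle\cdot,\cdot\rangle_X$, $\langle\cdot,\cdot\rangle_Y$ and norms $\|\cdot\|_X,\|\cdot\|_Y$; $X\times Y$ carries the product Hilbert structure, with norm $\|\cdot\|$. Standing assumptions: $f:X\to\mathbb R$ is convex and continuously differentiable; $\nabla f:X\to X$ is Lipschitz continuous on bounded sets; $A:X\to Y$ is linear and continuous with adjoint $A^*$; $b\in Y$. The Lagrangian is $L:X\times Y\to\mathbb R$, $L(x,\lambda)=f(x)+\langle\lambda,Ax-b\rangle_Y$. A saddle point of $L$ is a pair $(\bar x,\bar\lambda)\in X\times Y$ with $L(\bar x,\lambda)\le L(\bar x,\bar\lambda)\le L(x,\bar\lambda)$ for all $(x,\lambda)\in X\times Y$; the set of saddle points of $L$ is denoted by $S\times M\subset X\times Y$ (it is closed and convex). $\operatorname{proj}_{C}$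 denotes the orthogonal projection onto a non-empty closed convex set $C\subset X\times Y$. The system (AH) is $$\dot x+\nabla f(x)+A^*\lambda=0_X,\qquad \dot\lambda+b-Ax=0_Y,$$ with initial data $(x(0),\lambda(0))=(x_0,\lambda_0)\in X\times Y$; a solution is a function $(x,\lambda)\in\mathcal C^1([0,+\infty);X\times Y)$ satisfying the system on $[0,+\infty)$ with these initial data. *)

theory Defs
  imports "HOL-Analysis.Analysis"
begin

(* Real Hilbert spaces are types of sort {real_inner, complete_space}; the instances for
   products in HOL-Analysis give X \<times> Y the product Hilbert structure. *)

definition lagrangian ::
  "('a::real_inner \<Rightarrow> real) \<Rightarrow> ('a \<Rightarrow> 'b::real_inner) \<Rightarrow> 'b \<Rightarrow> 'a \<Rightarrow> 'b \<Rightarrow> real" where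
  "lagrangian f A b x l = f x + l \<bullet> (A x - b)"

definition saddle_points :: "('a \<Rightarrow> 'b \<Rightarrow> real) \<Rightarrow> ('a \<times> 'b) set" where
  "saddle_points L = {(xs, ls). \<forall>x l. L xs l \<le> L xs ls \<and> L xs ls \<le> L x ls}"

(* closest_point of HOL-Analysis requires a Heine-Borel (finite-dimensional) space. For closed,
   convex, non-empty C in a Hilbert space the minimiser below exists and is unique. *)
definition proj :: "'a::real_inner set \<Rightarrow> 'a \<Rightarrow> 'a" where
  "proj C z = (THE p. p \<in> C \<and> (\<forall>q\<in>C. dist z p \<le> dist z q))"

lemma proj_eqI:
  assumes "convex C" "closed C" "p \<in> C" "\<And>q. q \<in> C \<Longrightarrow> dist z p \<le> dist z q"
  shows "proj C z = p"
  unfolding proj_def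
proof (rule the_equality)
  show "p \<in> C \<and> (\<forall>q\<in>C. dist z p \<le> dist z q)"
    using assms by blast
next
  fix p' assume "p' \<in> C \<and> (\<forall>q\<in>C. dist z p' \<le> dist z q)"
  then show "p' = p"
    using any_closest_point_unique[of C p' p z] assms by blast
qed

definition weakly_tendsto ::
  "('i \<Rightarrow> 'a::real_normed_vector) \<Rightarrow> 'a \<Rightarrow> 'i filter \<Rightarrow> bool" where
  "weakly_tendsto z w F \<longleftrightarrow>
     (\<forall>\<phi>::'a \<Rightarrow> real. bounded_linear \<phi> \<longrightarrow> ((\<lambda>t. \<phi> (z t)) \<longlongrightarrow> \<phi> w) F)"

(* Class C^1 on [0,\<infinity>), with a one-sided derivative at 0. Only the values of x and l on
   [0,\<infinity>) matter. The argument g plays the role of the gradient of f. The library's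
   adjoint picks a map by choice; for bounded linear A on a Hilbert space one exists by Riesz and
   is unique. *)
definition AH_solution ::
  "('a::{real_inner, complete_space} \<Rightarrow> 'a) \<Rightarrow> ('a \<Rightarrow> 'b::{real_inner, complete_space}) \<Rightarrow> 'b
     \<Rightarrow> 'a \<Rightarrow> 'b \<Rightarrow> (real \<Rightarrow> 'a) \<Rightarrow> (real \<Rightarrow> 'b) \<Rightarrow> bool" where
  "AH_solution g A b x0 l0 x l \<longleftrightarrow>
     (\<exists>x' l'. continuous_on {0..} x' \<and> continuous_on {0..} l' \<and>
        (\<forall>t\<ge>0. (x has_vector_derivative x' t) (at t within {0..}) \<and>
               (l has_vector_derivative l' t) (at t within {0..}) \<and>
               x' t + g (x t) + adjoint A (l t) = 0 \<and>
               l' t + b - A (x t) = 0)) \<and>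
     x 0 = x0 \<and> l 0 = l0"

end

theory Submission
  imports Defs
begin

text \<open>Write \<open>S \<times> M\<close> for the saddle set. By strong monotonicity \<open>S\<close> is a single point, and
  any two multipliers differ by some \<open>k\<close> orthogonal to the range of \<open>A\<close>. Along a trajectory
  \<open>\<langle>\<lambda>(t), k\<rangle>\<close> is constant, because its derivative is \<open>\<langle>A (x(t) - x\<^sub>*), k\<rangle> = 0\<close>; passing to the weak
  limit shows that \<open>\<lambda>\<^sub>0\<close> minus the limit multiplier is orthogonal to \<open>k\<close>, and Pythagoras
  identifies the limit as the projection. Working with \<open>\<langle>k, A v\<rangle> = 0\<close> instead of \<open>A\<^sup>* k = 0\<close> avoids
  the existence of the adjoint, i.e. the Riesz representation theorem.\<close>

text \<open>The Lagrangian is affine in the multiplier, so it can be maximal at \<open>m\<close>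
  only if its slope \<open>A u - b\<close> vanishes; moving \<open>m\<close> by that slope shows
  this.\<close>

lemma saddle_points_lagrangian_feasible:
  assumes "(u, m) \<in> saddle_points (lagrangian f A b)"
  shows "A u = b"
proof -
  have "lagrangian f A b u (m + (A u - b)) \<le> lagrangian f A b u m"
    using assms by (auto simp: saddle_points_def)
  then have "(A u - b) \<bullet> (A u - b) \<le> 0"
    by (simp add: lagrangian_def inner_add_left)
  then show ?thesis
    by (metis inner_eq_zero_iff inner_ge_zero order_antisym right_minus_eq)
qed

text \<open>Fermat's rule: \<open>u\<close> minimises the Lagrangian at fixed \<open>m\<close> over
  the whole space. This is the equation D + A* m = 0 tested against \<open>v\<close>.\<close>

lemma saddle_points_lagrangian_stationary:
  assumes "(u, m) \<in> saddle_points (lagrangian f A b)"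
    and "GDERIV f u :> D" and "bounded_linear A"
  shows "v \<bullet> D + m \<bullet> A v = 0"
proof -
  have "((\<lambda>w. lagrangian f A b w m) has_derivative (\<lambda>h. h \<bullet> D + m \<bullet> (A h - 0))) (at u)"
    unfolding lagrangian_def
    by (intro derivative_intros bounded_linear_imp_has_derivative[OF assms(3)]
        assms(2)[unfolded gderiv_def])
  moreover have "\<forall>w\<in>UNIV. lagrangian f A b u m \<le> lagrangian f A b w m"
    using assms(1) by (auto simp: saddle_points_def)
  ultimately have "(\<lambda>h. h \<bullet> D + m \<bullet> (A h - 0)) = (\<lambda>h. 0)"
    using differential_zero_maxmin[of u UNIV] by blast
  then show ?thesis by (metis diff_zero)
qed

text \<open>By feasibility \<open>u - w\<close> lies in the kernel of \<open>A\<close>, so testing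
  stationarity with it removes the multipliers: both gradients are orthogonal to
  \<open>u - w\<close>, and strong monotonicity forces \<open>u = w\<close>.\<close>

lemma saddle_points_lagrangian_unique_primal:
  assumes "(u, m) \<in> saddle_points (lagrangian f A b)"
    and "(w, n) \<in> saddle_points (lagrangian f A b)"
    and "\<And>u. GDERIV f u :> g u" and "bounded_linear A" and "\<alpha> > 0"
    and "\<And>u v. (g u - g v) \<bullet> (u - v) \<ge> \<alpha> * (norm (u - v))\<^sup>2"
  shows "u = w"
proof -
  have "A (u - w) = 0"
    using saddle_points_lagrangian_feasible[OF assms(1)]
      saddle_points_lagrangian_feasible[OF assms(2)]
    by (simp add: bounded_linear.linear[OF assms(4)] linear_diff)
  then have "(u - w) \<bullet> g u = 0" "(u - w) \<bullet> g w = 0"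
    using saddle_points_lagrangian_stationary[OF assms(1,3,4), of "u - w"]
      saddle_points_lagrangian_stationary[OF assms(2,3,4), of "u - w"] by simp_all
  then have "(g u - g w) \<bullet> (u - w) = 0"
    by (simp add: inner_commute inner_diff_right)
  then have "\<alpha> * (norm (u - w))\<^sup>2 \<le> 0"
    using assms(6)[of u w] by simp
  then show ?thesis
    using \<open>\<alpha> > 0\<close> by (simp add: mult_le_0_iff)
qed

text \<open>The second assumption makes \<open>k\<close> orthogonal to every possible velocity
  \<open>A (x s) - b\<close> of the multiplier.\<close>

lemma AH_solution_inner_const:
  assumes "AH_solution g A b x0 l0 x l" and "\<And>v. k \<bullet> A v = k \<bullet> b" and "t \<ge> 0"
  shows "k \<bullet> l t = k \<bullet> l0"
proof -
  obtain l' where l': "\<And>s. s \<ge> 0 \<Longrightarrow> (l has_vector_derivative l' s) (at s within {0..})"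
      "\<And>s. s \<ge> 0 \<Longrightarrow> l' s + b - A (x s) = 0" and "l 0 = l0"
    using assms(1) unfolding AH_solution_def by blast
  have "((\<lambda>s. k \<bullet> l s) has_vector_derivative 0) (at s within {0..})" if "s \<in> {0..}" for s
  proof -
    have "l' s = A (x s) - b"
      using l'(2)[of s] that by (simp add: algebra_simps)
    then have "k \<bullet> l' s = 0"
      using assms(2) by (simp add: inner_diff_right)
    then show ?thesis
      using bounded_linear.has_vector_derivative[OF bounded_linear_inner_right l'(1), of s k] that
      by simp
  qed
  then obtain c where "\<And>s. s \<in> {0..} \<Longrightarrow> k \<bullet> l s = c"
    using has_vector_derivative_zero_constant[of "{0..}" "\<lambda>s. k \<bullet> l s"] by auto
  then show ?thesis
    using \<open>t \<ge> 0\<close> \<open>l 0 = l0\<close> by (metis atLeast_iff order_refl)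
qed

lemma weakly_tendsto_inner_snd:
  fixes z :: "'i \<Rightarrow> 'a::real_normed_vector \<times> 'b::real_inner"
  assumes "weakly_tendsto z w F"
  shows "((\<lambda>t. k \<bullet> snd (z t)) \<longlongrightarrow> k \<bullet> snd w) F"
  using assms bounded_linear_compose[OF bounded_linear_inner_right bounded_linear_snd]
  unfolding weakly_tendsto_def by blast

text \<open>The Pythagorean identity yields both minimality of \<open>p\<close> and its uniqueness:
  the excess of the squared distance at \<open>q\<close> is exactly
  \<open>(dist p q)\<^sup>2\<close>.\<close>

lemma proj_eqI_orthogonal:
  assumes "p \<in> C" and "\<And>q. q \<in> C \<Longrightarrow> (z - p) \<bullet> (q - p) = 0"
  shows "proj C z = p"
proof -
  have pyth: "(dist z q)\<^sup>2 = (dist z p)\<^sup>2 + (dist p q)\<^sup>2" if "q \<in> C" for q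
  proof -
    have "orthogonal (z - p) (p - q)"
      using assms(2)[OF that] by (simp add: orthogonal_def inner_diff_right)
    from norm_add_Pythagorean[OF this] show ?thesis
      by (simp add: dist_norm)
  qed
  show ?thesis
    unfolding proj_def
  proof (rule the_equality)
    have "dist z p \<le> dist z q" if "q \<in> C" for q
      using pyth[OF that] by (simp add: power2_le_imp_le)
    then show "p \<in> C \<and> (\<forall>q\<in>C. dist z p \<le> dist z q)"
      using assms(1) by blast
  next
    fix q assume q: "q \<in> C \<and> (\<forall>r\<in>C. dist z q \<le> dist z r)"
    then have "(dist z q)\<^sup>2 \<le> (dist z p)\<^sup>2"
      using assms(1) by (simp add: power_mono)
    then have "(dist p q)\<^sup>2 \<le> 0"
      using pyth[of q] q by simp
    then show "q = p" by simp
  qed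
qed

theorem corollary3p3:
  fixes f :: "'a::{real_inner, complete_space} \<Rightarrow> real"
    and gradf :: "'a \<Rightarrow> 'a"
    and A :: "'a \<Rightarrow> 'b::{real_inner, complete_space}"
    and b :: 'b
    and \<alpha> :: real
    and x :: "real \<Rightarrow> 'a" and l :: "real \<Rightarrow> 'b"
    and x0 xbar :: 'a and l0 lbar :: 'b
  assumes "convex_on UNIV f"
    and "\<And>u. GDERIV f u :> gradf u"
    and "continuous_on UNIV gradf"
    and "\<And>B. bounded B \<Longrightarrow> \<exists>C. C-lipschitz_on B gradf"
    and "bounded_linear A"
    and "\<alpha> > 0"
    and "\<And>u v. (gradf u - gradf v) \<bullet> (u - v) \<ge> \<alpha> * (norm (u - v))\<^sup>2"
    and "saddle_points (lagrangian f A b) \<noteq> {}"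
    and "AH_solution gradf A b x0 l0 x l"
    and "(xbar, lbar) \<in> saddle_points (lagrangian f A b)"
    and "weakly_tendsto (\<lambda>t. (x t, l t)) (xbar, lbar) at_top"
  shows "(xbar, lbar) = proj (saddle_points (lagrangian f A b)) (x0, l0)"
proof (rule sym, rule proj_eqI_orthogonal[OF assms(10)])
  fix q assume q: "q \<in> saddle_points (lagrangian f A b)"
  obtain \<mu> where \<mu>: "q = (xbar, \<mu>)"
    using saddle_points_lagrangian_unique_primal[OF assms(10) _ assms(2,5,6,7)] q
    by (metis surj_pair)
  define k where "k = \<mu> - lbar"
  have k: "k \<bullet> A v = 0" for v
    using saddle_points_lagrangian_stationary[OF q[unfolded \<mu>] assms(2,5), of v]
      saddle_points_lagrangian_stationary[OF assms(10,2,5), of v]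
    by (simp add: k_def inner_diff_left)
  \<comment> \<open>Feasibility puts \<open>b\<close> in the range of \<open>A\<close>, so
    \<open>k\<close> is orthogonal to \<open>b\<close> as well.\<close>
  moreover have "b = A xbar"
    using saddle_points_lagrangian_feasible[OF assms(10)] by simp
  ultimately have "k \<bullet> A v = k \<bullet> b" for v
    by simp
  then have "\<forall>\<^sub>F t in at_top. k \<bullet> l t = k \<bullet> l0"
    by (intro eventually_mono[OF eventually_ge_at_top[of 0]] AH_solution_inner_const[OF assms(9)])
  then have "((\<lambda>t. k \<bullet> l t) \<longlongrightarrow> k \<bullet> l0) at_top"
    by (rule tendsto_eventually)
  moreover have "((\<lambda>t. k \<bullet> l t) \<longlongrightarrow> k \<bullet> lbar) at_top"
    using weakly_tendsto_inner_snd[OF assms(11), of k] by simp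
  ultimately have "k \<bullet> l0 = k \<bullet> lbar"
    by (intro tendsto_unique[of at_top "\<lambda>t. k \<bullet> l t"]) auto
  \<comment> \<open>The primal component of \<open>q - (xbar, lbar)\<close> is zero, so only
    \<open>(l0 - lbar) \<bullet> k\<close> remains.\<close>
  then show "((x0, l0) - (xbar, lbar)) \<bullet> (q - (xbar, lbar)) = 0"
    unfolding \<mu> by (simp add: k_def[symmetric] inner_diff_left inner_diff_right inner_commute)
qed

end
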